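(* Let $\mathcal H$ be a separable Hilbert space, $\mu_{\mathrm{pr}}=N(0,\Gamma_{\mathrm{pr}})$ a Gaussian prior with self-adjoint, positive definite, trace-class covariance $\Gamma_{\mathrm{pr}}$ (symmetric square root $\Gamma_{\mathrm{pr}}^{1/2}$), $F:\mathcal H\to\mathbb{R}^m$ continuously differentiable, $y\in\mathbb{R}^m$, $\Gamma_{\mathrm{obs}}=S_{\mathrm{obs}}S_{\mathrm{obs}}^\top$ symmetric positive definite. Let the target measure $\mu_{\mathrm{tar}}$ be given by $\frac{d\mu_{\mathrm{tar}}}{d\mu_{\mathrm{pr}}}(u)\propto\exp\big(-\frac12(y-F(u))^\top\Gamma_{\mathrm{obs}}^{-1}(y-F(u))\big)$, and suppose $\mu_{\mathrm{tar}}$ is equivalent to $\mu_{\mathrm{pr}}$. Define $G(v)=S_{\mathrm{obs}}^{-1}(F(\Gamma_{\mathrm{pr}}^{1/2}v)-y)$, fix $v_{\mathrm{ref}}$, $u_{\mathrm{ref}}=\Gamma_{\mathrm{pr}}^{1/2}v_{\mathrm{ref}}$, and let $S_{\mathrm{obs}}^{-1}\nabla F(u_{\mathrm{ref}})\Gamma_{\mathrm{pr}}^{1/2}=\Psi\Lambda\Phi^\top$ be a rank-$r$ reduced SVD ($\Psi\in\mathbb{R}^{m\times r}$ orthonormal columns, $\Lambda$ diagonal positive, orthonormal right singular vectors $\phi_1,\dots,\phi_r\in\mathcal H$). Set $\chi_i=\Gamma_{\mathrm{pr}}^{1/2}\phi_i$, $X=[\chi_1,\dots,\chi_r]$, $R_i(u)=\langle\Gamma_{\mathrm{pr}}^{-1/2}u,\Gamma_{\mathrm{pr}}^{-1/2}\chi_i\rangle$,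 $Pu=\sum_i\chi_iR_i(u)$, $W^\perp=(I-P)\mathcal H$. Let $\mu_{\mathrm{RTO}}$ be the law of $u$ defined from $\zeta\sim\mu_{\mathrm{pr}}$ by $(I-P)\zeta=(I-P)u$ and $P\zeta=X\big[(\Lambda^2+I)^{-1/2}\big(R(u)+\Lambda\Psi^\top S_{\mathrm{obs}}^{-1}(F(u)-y)\big)\big]$. Suppose that for all $b\in W^\perp$ the mapping $\mathbb{R}^r\ni a\mapsto a+\Lambda\Psi^\top S_{\mathrm{obs}}^{-1}F(Xa+b)$ is Lipschitz continuous, injective, and has Lipschitz continuous inverse. Consider the Metropolis–Hastings algorithm targeting $\mu_{\mathrm{tar}}$ with independence proposal $q(u,du')=\mu_{\mathrm{RTO}}(du')$, whose acceptance probability is $\alpha(u,u')=\min\{1,\frac{d\nu^\perp}{d\nu}(u,u')\}$ with $\nu(du,du')=\mu_{\mathrm{RTO}}(du')\mu_{\mathrm{tar}}(du)$ and $\nu^\perp(du,du')=\mu_{\mathrm{RTO}}(du)\mu_{\mathrm{tar}}(du')$. Then $\alpha(u,u')>0$ for $\mu_{\mathrm{pr}}\times\mu_{\mathrm{pr}}$-almost every $(u,u')$.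
   Context: The measure $\mu_{\mathrm{RTO}}$ is the function-space randomize-then-optimize (RTO) proposal, which modifies a prior draw only along the finite-dimensional subspace spanned by $\chi_1,\dots,\chi_r$. The acceptance probability of Metropolis–Hastings is the standard general-state-space one defined through the Radon–Nikodym derivative of $\nu^\perp$ with respect to $\nu$. *)

theory Defs
  imports "HOL-Probability.Probability"
begin

definition self_adjoint :: "('a::real_inner \<Rightarrow> 'a) \<Rightarrow> bool" where
  "self_adjoint C \<longleftrightarrow> (\<forall>x y. C x \<bullet> y = x \<bullet> C y)"

definition positive_definite_op :: "('a::real_inner \<Rightarrow> 'a) \<Rightarrow> bool" where
  "positive_definite_op C \<longleftrightarrow> (\<forall>x. x \<noteq> 0 \<longrightarrow> C x \<bullet> x > 0)"

definition positive_op :: "('a::real_inner \<Rightarrow> 'a) \<Rightarrow> bool" where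
  "positive_op C \<longleftrightarrow> (\<forall>x. C x \<bullet> x \<ge> 0)"

definition hilbert_basis :: "'a::real_inner set \<Rightarrow> bool" where
  "hilbert_basis B \<longleftrightarrow> (\<forall>e\<in>B. norm e = 1) \<and> (\<forall>e\<in>B. \<forall>f\<in>B. e \<noteq> f \<longrightarrow> e \<bullet> f = 0)
     \<and> closure (span B) = UNIV"

definition trace_class_pos :: "('a::real_inner \<Rightarrow> 'a) \<Rightarrow> bool" where
  "trace_class_pos C \<longleftrightarrow> (\<exists>B. hilbert_basis B \<and> (\<lambda>e. C e \<bullet> e) summable_on B)"

definition is_sqrt_op :: "('a::real_inner \<Rightarrow> 'a) \<Rightarrow> ('a \<Rightarrow> 'a) \<Rightarrow> bool" where
  "is_sqrt_op C S \<longleftrightarrow> bounded_linear S \<and> self_adjoint S \<and> positive_op S \<and> (\<forall>x. S (S x) = C x)"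

definition gaussian_measure :: "'a::real_inner measure \<Rightarrow> ('a \<Rightarrow> 'a) \<Rightarrow> bool" where
  "gaussian_measure M C \<longleftrightarrow> prob_space M \<and> sets M = sets borel \<and>
     (\<forall>h. (CLINT x|M. cis (x \<bullet> h)) = complex_of_real (exp (- (C h \<bullet> h) / 2)))"

text \<open>Metropolis--Hastings acceptance probability for the independence proposal
  q(u,du') = muRTO(du') targeting muTar:
  alpha(u,u') = min 1 (d nu_perp / d nu)(u,u') with
  nu(du,du') = muTar(du) muRTO(du'), nu_perp(du,du') = muRTO(du) muTar(du').\<close>
definition mh_alpha :: "'a measure \<Rightarrow> 'a measure \<Rightarrow> 'a \<times> 'a \<Rightarrow> ennreal" where
  "mh_alpha muTar muRTO p =
     min 1 (RN_deriv (muTar \<Otimes>\<^sub>M muRTO) (muRTO \<Otimes>\<^sub>M muTar) p)"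


definition misfit :: "real ^ 'm ^ 'm \<Rightarrow> ('a \<Rightarrow> real ^ 'm) \<Rightarrow> real ^ 'm \<Rightarrow> 'a \<Rightarrow> real" where
  "misfit S_obs F y u = (y - F u) \<bullet> (matrix_inv (S_obs ** transpose S_obs) *v (y - F u))"

definition Xmap :: "('a::real_vector \<Rightarrow> 'a) \<Rightarrow> ('r::finite \<Rightarrow> 'a) \<Rightarrow> real ^ 'r \<Rightarrow> 'a" where
  "Xmap Ghalf phi a = (\<Sum>i\<in>UNIV. (a $ i) *\<^sub>R Ghalf (phi i))"

text \<open>R_i(u) = < Gamma^{-1/2} u, Gamma^{-1/2} chi_i >, written with Gamma^{-1/2} moved
  to the second argument (well defined, continuous in u, since chi_i lies in the range of Gamma).\<close>
definition Rfun :: "('a::real_inner \<Rightarrow> 'a) \<Rightarrow> ('r::finite \<Rightarrow> 'a) \<Rightarrow> 'r \<Rightarrow> 'a \<Rightarrow> real" where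
  "Rfun Ghalf phi i u = u \<bullet> inv Ghalf (inv Ghalf (Ghalf (phi i)))"

definition Pmap :: "('a::real_inner \<Rightarrow> 'a) \<Rightarrow> ('r::finite \<Rightarrow> 'a) \<Rightarrow> 'a \<Rightarrow> 'a" where
  "Pmap Ghalf phi u = (\<Sum>i\<in>UNIV. Rfun Ghalf phi i u *\<^sub>R Ghalf (phi i))"

text \<open>The RTO map u \<mapsto> zeta:  (I-P) zeta = (I-P) u,
  P zeta = X[(Lambda^2+I)^{-1/2}(R(u) + Lambda Psi^T S_obs^{-1}(F(u)-y))].\<close>
definition rto_map :: "('a::real_inner \<Rightarrow> 'a) \<Rightarrow> ('r::finite \<Rightarrow> 'a) \<Rightarrow> ('r \<Rightarrow> real)
    \<Rightarrow> ('r \<Rightarrow> real ^ 'm) \<Rightarrow> real ^ 'm ^ 'm \<Rightarrow> ('a \<Rightarrow> real ^ 'm) \<Rightarrow> real ^ 'm \<Rightarrow> 'a \<Rightarrow> 'a" where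
  "rto_map Ghalf phi lam Psi S_obs F y u =
     (u - Pmap Ghalf phi u) + Xmap Ghalf phi
       (\<chi> i. (Rfun Ghalf phi i u + lam i * (Psi i \<bullet> (matrix_inv S_obs *v (F u - y))))
              / sqrt ((lam i)\<^sup>2 + 1))"

end

theory Submission
  imports Defs
begin

text \<open>The acceptance probability can vanish on a set of positive measure only if \<open>mu_RTO\<close> and
  \<open>mu_pr\<close> fail to be equivalent, for otherwise the two product measures are equivalent and the
  Radon--Nikodym derivative is positive almost everywhere. By comparing characteristic functions,
  the prior is the law of \<open>(u - P u) + X a\<close> with \<open>u\<close> drawn from the prior and an independent standard
  Gaussian vector \<open>a\<close>; hence a Borel set is a null set of the prior iff almost all of its slices along
  the fibers \<open>b + X a\<close> are Lebesgue negligible. The RTO map \<open>T\<close> maps each fiber to itself and is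
  bi-Lipschitz there, so it is injective and \<open>K\<close> is a prior null set iff \<open>T ` K\<close> is one. Since
  \<open>mu_pr\<close> is the image of \<open>mu_RTO\<close> under \<open>T\<close>, this gives the equivalence.\<close>

lemma borel_measurable_cis [measurable]: "cis \<in> borel_measurable borel"
  by (intro borel_measurable_continuous_onI continuous_intros)

section \<open>Characteristic functions in a separable inner product space\<close>

text \<open>Levy uniqueness concerns probability laws, so both measures are rescaled by their common
  mass, which \<open>t = 0\<close> reads off; mass zero is split off because it cannot be
  normalized.\<close>

lemma finite_measure_eqI_cis:
  fixes M N :: "real measure"
  assumes M: "finite_measure M" "sets M = sets borel" and N: "finite_measure N" "sets N = sets borel"
    and eq: "\<And>t. (CLINT x|M. cis (t * x)) = (CLINT x|N. cis (t * x))"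
  shows "M = N"
proof -
  interpret M: finite_measure M by fact
  interpret N: finite_measure N by fact
  have [measurable_cong]: "sets M = sets borel" "sets N = sets borel" by fact+
  have sp: "space M = UNIV" "space N = UNIV"
    using sets_eq_imp_space_eq[OF M(2)] sets_eq_imp_space_eq[OF N(2)] by auto
  define m where "m = measure M UNIV"
  have m: "measure N UNIV = m"
    using eq[of 0] sp by (simp add: m_def)
  show ?thesis
  proof (cases "m = 0")
    case True
    have "emeasure M A = 0" "emeasure N A = 0" for A
      using M.emeasure_eq_measure[of A] N.emeasure_eq_measure[of A] M.bounded_measure[of A] N.bounded_measure[of A] True m sp
      by (simp_all add: m_def measure_le_0_iff)
    then show ?thesis
      by (intro measure_eqI) (simp_all add: M N)
  next
    case False
    then have mpos: "m > 0" by (simp add: m_def less_le)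
    define s where "s = (\<lambda>K::real measure. density K (\<lambda>_. ennreal (1 / m)))"
    have em: "emeasure (s K) A = ennreal (1 / m) * emeasure K A" if "A \<in> sets K" for K A
      using that by (simp add: s_def emeasure_density_const)
    have dist: "real_distribution (s K)" if "finite_measure K" "sets K = sets borel" "measure K UNIV = m" for K
    proof -
      interpret finite_measure K by fact
      have "space K = UNIV" using sets_eq_imp_space_eq[OF that(2)] by simp
      then have "emeasure (s K) (space (s K)) = 1"
        using mpos that em[of UNIV K] emeasure_eq_measure[of UNIV] by (simp add: s_def flip: ennreal_mult)
      then show ?thesis
        by (intro real_distribution.intro real_distribution_axioms.intro prob_spaceI)
           (auto simp: s_def that)
    qed
    have ch: "char (s K) t = (1 / m) *\<^sub>R (CLINT x|K. cis (t * x))" if "sets K = sets borel" for K t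
    proof -
      have [measurable_cong]: "sets K = sets borel" by fact
      have "char (s K) t = (CLINT x|s K. cis (t * x))"
        by (simp add: char_def cis_conv_exp)
      also have "\<dots> = (CLINT x|K. (1 / m) *\<^sub>R cis (t * x))"
        unfolding s_def using mpos by (subst integral_density) auto
      finally show ?thesis by (metis integral_scaleR_right)
    qed
    have "s M = s N"
      using M N m_def m by (intro Levy_uniqueness dist ext) (auto simp: ch eq)
    have "emeasure M A = emeasure N A" if "A \<in> sets M" for A
    proof -
      have "emeasure K A = ennreal m * emeasure (s K) A" if "A \<in> sets K" for K
        using that mpos by (simp add: em flip: ennreal_mult mult.assoc)
      then show ?thesis using \<open>s M = s N\<close> that M N by auto
    qed
    then show ?thesis by (intro measure_eqI) (simp_all add: M N)
  qed
qed

abbreviation halfspace :: "'a::real_inner \<times> real \<Rightarrow> 'a set" where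
  "halfspace p \<equiv> {x. x \<bullet> fst p \<le> snd p}"

text \<open>Finite rather than probability measures: the relation has to survive restriction to
  half-spaces, which loses mass.\<close>

definition same_cf :: "'a::real_inner measure \<Rightarrow> 'a measure \<Rightarrow> bool" where
  "same_cf M N \<longleftrightarrow> finite_measure M \<and> finite_measure N \<and> sets M = sets borel \<and> sets N = sets borel \<and>
     (\<forall>h. (CLINT x|M. cis (x \<bullet> h)) = (CLINT x|N. cis (x \<bullet> h)))"

lemma (in finite_measure) integrable_bounded_by_const:
  fixes f :: "'a \<Rightarrow> 'b::{banach, second_countable_topology}"
  assumes "f \<in> borel_measurable M" "\<And>x. norm (f x) \<le> B"
  shows "integrable M f"
  using assms by (intro integrable_const_bound[of _ B]) auto

text \<open>Euler's formula writes the weight as a combination of exponentials, so the weighted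
  integral depends on \<open>M\<close> only through its characteristic function.\<close>

lemma integral_one_plus_cos_cis:
  fixes M :: "'a::{real_inner, second_countable_topology} measure"
  assumes "finite_measure M" "sets M = sets borel"
  shows "(CLINT x|M. of_real (1 + cos (x \<bullet> h + s)) * cis (t * (x \<bullet> k)))
    = (CLINT x|M. cis (x \<bullet> (t *\<^sub>R k))) +
      (cis s * (CLINT x|M. cis (x \<bullet> (h + t *\<^sub>R k))) + cis (- s) * (CLINT x|M. cis (x \<bullet> (t *\<^sub>R k - h)))) / 2"
proof -
  interpret finite_measure M by fact
  have [measurable_cong]: "sets M = sets borel" by fact
  have int: "integrable M (\<lambda>x. cis (x \<bullet> v))" for v
    by (rule integrable_bounded_by_const[of _ 1]) auto
  have "of_real (1 + cos (x \<bullet> h + s)) * cis (t * (x \<bullet> k)) = cis (x \<bullet> (t *\<^sub>R k)) +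
      (cis s * cis (x \<bullet> (h + t *\<^sub>R k)) + cis (- s) * cis (x \<bullet> (t *\<^sub>R k - h))) / 2" for x
  proof -
    define \<theta> where "\<theta> = x \<bullet> h + s"
    have "complex_of_real (1 + cos \<theta>) = 1 + (cis \<theta> + cis (- \<theta>)) / 2"
      by (simp add: complex_eq_iff)
    moreover have "cis s * cis (x \<bullet> (h + t *\<^sub>R k)) = cis \<theta> * cis (t * (x \<bullet> k))"
      "cis (- s) * cis (x \<bullet> (t *\<^sub>R k - h)) = cis (- \<theta>) * cis (t * (x \<bullet> k))"
      by (simp_all add: \<theta>_def cis_mult inner_add_right inner_diff_right algebra_simps)
    ultimately show ?thesis
      unfolding \<theta>_def[symmetric] by (simp add: distrib_right add_divide_distrib)
  qed
  then show ?thesis using int by (simp del: of_real_add inner_scaleR_right)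
qed

text \<open>The weight is nonnegative, so the weighted law of \<open>x \<bullet> k\<close> is a
  genuine measure on the line. Its transform is determined by the characteristic function of the
  original measure, and one-dimensional uniqueness allows testing it against the half-line
  \<open>{..c}\<close>.\<close>

lemma same_cf_halfspace_integral:
  fixes M N :: "'a::{real_inner, second_countable_topology} measure"
  assumes "same_cf M N"
  shows "(LINT x|M. indicator (halfspace p) x * (1 + cos (x \<bullet> h + s)))
       = (LINT x|N. indicator (halfspace p) x * (1 + cos (x \<bullet> h + s)))"
proof -
  define k c where "k = fst p" and "c = snd p"
  define w where "w = (\<lambda>x::'a. 1 + cos (x \<bullet> h + s))"
  have [measurable]: "w \<in> borel_measurable borel" unfolding w_def by measurable
  have w0: "0 \<le> w x" "w x \<le> 2" for x
    using cos_ge_minus_one[of "x \<bullet> h + s"] cos_le_one[of "x \<bullet> h + s"] unfolding w_def by linarith+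
  define d where "d = (\<lambda>K. distr (density K (\<lambda>x. ennreal (w x))) borel (\<lambda>x. x \<bullet> k))"
  have fin: "finite_measure (d K)" if "finite_measure K" and [measurable_cong]: "sets K = sets borel" for K
  proof -
    interpret finite_measure K by fact
    have "integrable K w"
      by (rule integrable_bounded_by_const[of _ 2]) (use w0 in auto)
    then have "finite_measure (density K (\<lambda>x. ennreal (w x)))"
    proof (intro finite_measureI)
      have "emeasure (density K (\<lambda>x. ennreal (w x))) (space K) = (\<integral>\<^sup>+x. ennreal (w x) \<partial>K)"
        by (subst emeasure_density) (auto intro!: nn_integral_cong)
      also have "\<dots> = ennreal (LINT x|K. w x)"
        using \<open>integrable K w\<close> w0 by (intro nn_integral_eq_integral) auto
      finally show "emeasure (density K (\<lambda>x. ennreal (w x))) (space (density K (\<lambda>x. ennreal (w x)))) \<noteq> \<infinity>"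
        by simp
    qed
    then show ?thesis unfolding d_def
      by (rule finite_measure.finite_measure_distr) simp
  qed
  have int_d: "integral\<^sup>L (d K) g = (\<integral>x. w x *\<^sub>R g (x \<bullet> k) \<partial>K)"
    if [measurable_cong]: "sets K = sets borel" and [measurable]: "g \<in> borel_measurable borel"
    for K and g :: "real \<Rightarrow> 'b::{banach, second_countable_topology}"
  proof -
    have "integral\<^sup>L (d K) g = (\<integral>x. g (x \<bullet> k) \<partial>density K (\<lambda>x. ennreal (w x)))"
      unfolding d_def by (rule integral_distr) measurable
    also have "\<dots> = (\<integral>x. w x *\<^sub>R g (x \<bullet> k) \<partial>K)"
      by (rule integral_density) (simp_all add: w0)
    finally show ?thesis .
  qed
  have sets: "sets M = sets borel" "sets N = sets borel" and finMN: "finite_measure M" "finite_measure N"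
    and eq: "\<And>h. (CLINT x|M. cis (x \<bullet> h)) = (CLINT x|N. cis (x \<bullet> h))"
    using assms by (simp_all add: same_cf_def)
  have "d M = d N"
  proof (rule finite_measure_eqI_cis)
    fix t
    have "(CLINT x|d K. cis (t * x)) = (CLINT x|K. of_real (1 + cos (x \<bullet> h + s)) * cis (t * (x \<bullet> k)))"
      if "sets K = sets borel" for K
      using that by (simp add: int_d w_def scaleR_conv_of_real)
    then show "(CLINT x|d M. cis (t * x)) = (CLINT x|d N. cis (t * x))"
      using sets finMN by (simp only: integral_one_plus_cos_cis eq)
    show "finite_measure (d M)" "finite_measure (d N)" using fin sets finMN by blast+
    show "sets (d M) = sets borel" "sets (d N) = sets borel" by (simp_all add: d_def)
  qed
  have half: "(LINT x|d K. indicator {..c} x) = (LINT x|K. indicator (halfspace p) x * (1 + cos (x \<bullet> h + s)))"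
    if "sets K = sets borel" for K
  proof -
    have "(LINT x|d K. indicator {..c} x :: real) = (LINT x|K. w x *\<^sub>R indicator {..c} (x \<bullet> k))"
      using that by (intro int_d) measurable
    also have "\<dots> = (LINT x|K. indicator (halfspace p) x * (1 + cos (x \<bullet> h + s)))"
      by (intro Bochner_Integration.integral_cong refl) (simp add: indicator_def k_def c_def w_def)
    finally show ?thesis .
  qed
  show ?thesis
    unfolding half[OF sets(1), symmetric] half[OF sets(2), symmetric] \<open>d M = d N\<close> by (rule refl)
qed

text \<open>Restricting to a half-space preserves equality of characteristic functions: the nonnegative
  weights \<open>1 + cos (x \<bullet> h + s)\<close> reduce this to uniqueness for measures on the line, and the phases
  \<open>s = 0\<close> and \<open>s = - pi / 2\<close> recover the real and imaginary parts of \<open>cis (x \<bullet> h)\<close>.\<close>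

lemma same_cf_density_halfspace:
  fixes M N :: "'a::{real_inner, second_countable_topology} measure"
  assumes cf: "same_cf M N"
  shows "same_cf (density M (indicator (halfspace p))) (density N (indicator (halfspace p)))"
proof -
  let ?H = "halfspace p"
  have H[measurable]: "?H \<in> sets borel" by measurable
  have fin: "finite_measure (density K (indicator ?H))" if "finite_measure K" "sets K = sets borel" for K
  proof -
    interpret finite_measure K by fact
    have "space K = UNIV" using sets_eq_imp_space_eq[OF that(2)] by simp
    then show ?thesis
      using that by (intro finite_measureI) (simp add: emeasure_restricted)
  qed
  \<comment> \<open>With \<open>h = 0\<close> and \<open>s = 0\<close> the weight is the constant 2,
    so half of that integral is the mass of the half-space; subtracting it removes the 1 from the
    weight and leaves the integral of the cosine or sine.\<close>
  have int: "(CLINT x|density K (indicator ?H). cis (x \<bullet> h)) =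
      Complex ((LINT x|K. indicator ?H x * (1 + cos (x \<bullet> h + 0))) - (LINT x|K. indicator ?H x * (1 + cos (x \<bullet> 0 + 0))) / 2)
        ((LINT x|K. indicator ?H x * (1 + cos (x \<bullet> h + (- pi / 2)))) - (LINT x|K. indicator ?H x * (1 + cos (x \<bullet> 0 + 0))) / 2)"
    if "finite_measure K" and [measurable_cong]: "sets K = sets borel" for K h
  proof -
    interpret finite_measure K by fact
    have eq: "(CLINT x|density K (indicator ?H). cis (x \<bullet> h)) = (CLINT x|K. indicator ?H x *\<^sub>R cis (x \<bullet> h))"
      by (subst integral_density[of _ _ "indicator ?H", simplified ennreal_indicator]) auto
    have i1: "integrable K (\<lambda>x. indicator ?H x *\<^sub>R cis (x \<bullet> h))"
      by (rule integrable_bounded_by_const[of _ 1]) (auto simp: indicator_def)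
    have i2: "integrable K (\<lambda>x. indicator ?H x * cos (x \<bullet> h))" "integrable K (\<lambda>x. indicator ?H x * sin (x \<bullet> h))"
      "integrable K (\<lambda>x. indicator ?H x :: real)"
      by (rule integrable_bounded_by_const[of _ 1]; auto simp: indicator_def)+
    have c: "cos (x - pi / 2) = sin x" for x :: real
      by (simp add: cos_diff)
    show ?thesis
      unfolding eq using i1 i2
      by (intro complex_eqI) (simp_all add: c distrib_left flip: integral_Re integral_Im)
  qed
  show ?thesis
    using cf fin unfolding same_cf_def by (simp only: int same_cf_halfspace_integral[OF cf] sets_density simp_thms)
qed

text \<open>Each half-space of the list is absorbed into the measures as a density, which keeps the
  characteristic functions equal; hence the induction generalizes over \<open>M\<close> and
  \<open>N\<close>. For the empty list, the frequency 0 compares total masses.\<close>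

lemma same_cf_halfspaces:
  fixes M N :: "'a::{real_inner, second_countable_topology} measure"
  assumes "same_cf M N"
  shows "emeasure M (\<Inter>p\<in>set L. halfspace p) = emeasure N (\<Inter>p\<in>set L. halfspace p)"
  using assms
proof (induction L arbitrary: M N)
  case Nil
  then have "finite_measure M" "finite_measure N" and sp: "space M = UNIV" "space N = UNIV"
    using sets_eq_imp_space_eq[of M borel] sets_eq_imp_space_eq[of N borel] by (simp_all add: same_cf_def)
  moreover have "measure M UNIV = measure N UNIV"
    using Nil sp unfolding same_cf_def by (auto dest!: spec[of _ 0])
  ultimately show ?case by (simp add: finite_measure.emeasure_eq_measure)
next
  case (Cons p L)
  have "emeasure K (\<Inter>q\<in>set (p # L). halfspace q) =
      emeasure (density K (indicator (halfspace p))) (\<Inter>q\<in>set L. halfspace q)"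
    if "sets K = sets borel" for K :: "'a measure"
  proof -
    have "(\<Inter>q\<in>set L. halfspace q) \<in> sets borel" by (cases "L = []") auto
    then show ?thesis
      using that by (simp add: emeasure_restricted)
  qed
  then show ?case
    using Cons.IH[OF same_cf_density_halfspace[OF Cons.prems, of p]] Cons.prems by (simp add: same_cf_def)
qed

section \<open>Half-spaces as generators of the Borel sets in a separable space\<close>

lemma cball_eq_INT_halfspaces:
  fixes D :: "'a::real_inner set"
  assumes dense: "\<And>X. open X \<Longrightarrow> X \<noteq> {} \<Longrightarrow> \<exists>d\<in>D. d \<in> X" and "r \<ge> 0"
  shows "cball c r = (\<Inter>d\<in>D. halfspace (d, c \<bullet> d + r * norm d))"
proof (intro equalityI subsetI INT_I)
  fix x d assume "x \<in> cball c r"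
  then have "norm (x - c) \<le> r" by (simp add: dist_norm norm_minus_commute)
  then have "(x - c) \<bullet> d \<le> r * norm d"
    by (meson norm_cauchy_schwarz mult_right_mono norm_ge_zero order_trans)
  then show "x \<in> halfspace (d, c \<bullet> d + r * norm d)" by (simp add: inner_diff_left)
next
  fix x assume x: "x \<in> (\<Inter>d\<in>D. halfspace (d, c \<bullet> d + r * norm d))"
  \<comment> \<open>The inequality is closed in \<open>d\<close>, hence extends from the dense set
    \<open>D\<close> to all directions; the direction \<open>x - c\<close> itself then bounds the
    distance by \<open>r\<close>.\<close>
  have cl: "closed {d. (x - c) \<bullet> d \<le> r * norm d}"
    by (intro closed_Collect_le continuous_intros)
  have "D \<subseteq> {d. (x - c) \<bullet> d \<le> r * norm d}"
    using x by (auto simp: inner_diff_left)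
  with cl dense[of "- {d. (x - c) \<bullet> d \<le> r * norm d}"] have "(x - c) \<bullet> (x - c) \<le> r * norm (x - c)"
    by (auto simp: open_Compl)
  then have "norm (x - c) * norm (x - c) \<le> r * norm (x - c)"
    by (simp add: dot_square_norm power2_eq_square)
  then have "norm (x - c) \<le> r"
    using assms(2) by (cases "norm (x - c) = 0") (auto simp: mult_le_cancel_right)
  then show "x \<in> cball c r" by (simp add: dist_norm norm_minus_commute)
qed

text \<open>Finite intersections replace single half-spaces so that the generator is a pi-system.
  Separability makes closed balls countable intersections of half-spaces, and open sets countable
  unions of closed balls with rational radii.\<close>

lemma borel_eq_sigma_halfspaces:
  "sets (borel :: 'a::{real_inner, second_countable_topology} measure)
     = sigma_sets UNIV (range (\<lambda>L. \<Inter>p\<in>set L. halfspace p))" (is "_ = sigma_sets UNIV ?E")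
proof (rule antisym)
  show "sigma_sets UNIV ?E \<subseteq> sets (borel :: 'a measure)"
  proof (intro sets.sigma_sets_subset[of _ borel, simplified] subsetI)
    fix X :: "'a set" assume "X \<in> ?E"
    then obtain L :: "('a \<times> real) list" where "X = (\<Inter>p\<in>set L. halfspace p)" by auto
    then show "X \<in> sets borel" by (cases "L = []") auto
  qed
  interpret sigma_algebra UNIV "sigma_sets UNIV ?E" by (rule sigma_algebra_sigma_sets) simp
  obtain D :: "'a set" where D: "countable D" and dense: "\<And>X. open X \<Longrightarrow> X \<noteq> {} \<Longrightarrow> \<exists>d\<in>D. d \<in> X"
    using countable_dense_exists by blast
  from dense[of UNIV] have "D \<noteq> {}" by auto
  have hs: "halfspace p \<in> sigma_sets UNIV ?E" for p
    by (intro sigma_sets.Basic image_eqI[of _ _ "[p]"]) auto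
  have cb: "cball c r \<in> sigma_sets UNIV ?E" if "r \<ge> 0" for c r
  proof -
    have "cball c r = (\<Inter>d\<in>D. halfspace (d, c \<bullet> d + r * norm d))"
      using dense that by (rule cball_eq_INT_halfspaces)
    also have "\<dots> \<in> sigma_sets UNIV ?E"
      using D \<open>D \<noteq> {}\<close> by (rule countable_INT') (use hs in blast)
    finally show ?thesis .
  qed
  have "U \<in> sigma_sets UNIV ?E" if "open U" for U :: "'a set"
  proof -
    let ?I = "{(d, q) \<in> D \<times> \<rat>. q \<ge> 0 \<and> cball d q \<subseteq> U}"
    have "U = (\<Union>(d, q)\<in>?I. cball d q)"
    proof (intro equalityI subsetI)
      fix x assume "x \<in> U"
      then obtain e where e: "e > 0" "ball x e \<subseteq> U" using \<open>open U\<close> open_contains_ball by metis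
      obtain q where q: "q \<in> \<rat>" "0 < q" "q < e / 2"
        using Rats_dense_in_real[of 0 "e / 2"] e by auto
      obtain d where d: "d \<in> D" "dist x d < q" using dense[of "ball x q"] q by auto
      have "cball d q \<subseteq> ball x e"
      proof
        fix z assume "z \<in> cball d q"
        then show "z \<in> ball x e" using dist_triangle[of x z d] d q by auto
      qed
      then show "x \<in> (\<Union>(d, q)\<in>?I. cball d q)"
        using d q e by (intro UN_I[of "(d, q)"]) (auto simp: dist_commute)
    qed auto
    moreover have "countable ?I"
      using D countable_rat by (intro countable_subset[of ?I "D \<times> \<rat>"]) auto
    then have "(\<Union>(d, q)\<in>?I. cball d q) \<in> sigma_sets UNIV ?E"
      by (intro countable_UN') (auto intro!: cb)
    ultimately show ?thesis by simp
  qed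
  then show "sets (borel :: 'a measure) \<subseteq> sigma_sets UNIV ?E"
    unfolding borel_def by (auto simp: intro!: sigma_sets_subset)
qed

text \<open>Uniqueness on a generating pi-system: concatenating lists intersects the corresponding
  sets, and the empty list yields the whole space.\<close>

theorem same_cf_imp_eq:
  fixes M N :: "'a::{real_inner, second_countable_topology} measure"
  assumes "same_cf M N"
  shows "M = N"
proof (rule measure_eqI_generator_eq[where E = "range (\<lambda>L. \<Inter>p\<in>set L. halfspace p)" and \<Omega> = UNIV and A = "\<lambda>_. UNIV"])
  show "Int_stable (range (\<lambda>L::('a \<times> real) list. \<Inter>p\<in>set L. halfspace p))"
  proof (rule Int_stableI)
    fix X Y :: "'a set"
    assume "X \<in> range (\<lambda>L. \<Inter>p\<in>set L. halfspace p)" "Y \<in> range (\<lambda>L. \<Inter>p\<in>set L. halfspace p)"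
    then obtain L L' where "X = (\<Inter>p\<in>set L. halfspace p)" "Y = (\<Inter>p\<in>set L'. halfspace p)" by auto
    then show "X \<inter> Y \<in> range (\<lambda>L. \<Inter>p\<in>set L. halfspace p)"
      by (intro image_eqI[of _ _ "L @ L'"]) auto
  qed
  show "range (\<lambda>_. UNIV) \<subseteq> range (\<lambda>L. \<Inter>p\<in>set L. halfspace p)"
    by (auto intro!: image_eqI[of _ _ "[]"])
  show "emeasure M UNIV \<noteq> \<infinity>"
    using assms finite_measure.emeasure_finite by (auto simp: same_cf_def)
  show "sets M = sigma_sets UNIV (range (\<lambda>L. \<Inter>p\<in>set L. halfspace p))"
    "sets N = sigma_sets UNIV (range (\<lambda>L. \<Inter>p\<in>set L. halfspace p))"
    using assms by (simp_all only: same_cf_def borel_eq_sigma_halfspaces)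
  show "emeasure M X = emeasure N X" if "X \<in> range (\<lambda>L. \<Inter>p\<in>set L. halfspace p)" for X
    using that same_cf_halfspaces[OF assms] by auto
qed auto

text \<open>The representing vector minimizes \<open>w \<bullet> w - 2 * f w\<close>.\<close>

lemma riesz_representation:
  fixes f :: "'a::{real_inner, complete_space} \<Rightarrow> real"
  assumes "bounded_linear f"
  obtains w where "\<And>x. f x = w \<bullet> x"
proof -
  interpret f: bounded_linear f by fact
  define J where "J = (\<lambda>w. w \<bullet> w - 2 * f w)"
  obtain K where K: "\<And>x. norm (f x) \<le> norm x * K" using f.bounded by blast
  have lower: "- K\<^sup>2 \<le> J w" for w
  proof -
    have "f w \<le> norm w * K" using K[of w] by simp
    moreover have "0 \<le> (norm w - K)\<^sup>2" by simp
    ultimately show ?thesis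
      by (simp add: J_def power2_norm_eq_inner[symmetric] power2_diff)
  qed
  define m where "m = Inf (range J)"
  have bdd: "bdd_below (range J)" using lower by (intro bdd_belowI[of _ "- K\<^sup>2"]) auto
  then have m_le: "m \<le> J w" for w unfolding m_def by (intro cInf_lower) auto
  have "\<exists>w. J w < m + inverse (real (Suc n))" for n
    using cInf_lessD[of "range J" "m + inverse (real (Suc n))"] by (auto simp: m_def)
  then obtain w where w: "\<And>n. J (w n) < m + inverse (real (Suc n))" by metis
  \<comment> \<open>Parallelogram identity: the midpoint also has value at least \<open>m\<close>,
    so near-minimizers are close to each other, which makes \<open>w\<close> a Cauchy
    sequence.\<close>
  have par: "(norm (u - v))\<^sup>2 \<le> 2 * (J u - m) + 2 * (J v - m)" for u v
  proof -
    have "(norm (u - v))\<^sup>2 = 2 * J u + 2 * J v - 4 * J ((1 / 2) *\<^sub>R (u + v))"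
      unfolding J_def power2_norm_eq_inner
      by (simp add: f.add f.scaleR inner_simps inner_commute algebra_simps)
    then show ?thesis using m_le[of "(1 / 2) *\<^sub>R (u + v)"] by simp
  qed
  have "Cauchy w"
  proof (rule metric_CauchyI)
    fix e :: real assume "e > 0"
    then obtain N where N: "inverse (real (Suc N)) < e\<^sup>2 / 4"
      using reals_Archimedean[of "e\<^sup>2 / 4"] by auto
    have "dist (w i) (w j) < e" if "i \<ge> N" "j \<ge> N" for i j
    proof -
      have "inverse (real (Suc k)) \<le> inverse (real (Suc N))" if "k \<ge> N" for k
        using that by (simp add: le_imp_inverse_le)
      then have "J (w i) - m < e\<^sup>2 / 4" "J (w j) - m < e\<^sup>2 / 4"
        using w[of i] w[of j] N that by (smt (verit))+
      then have "(norm (w i - w j))\<^sup>2 < e\<^sup>2" using par[of "w i" "w j"] by simp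
      then show ?thesis
        using \<open>e > 0\<close> by (simp add: dist_norm power_less_imp_less_base)
    qed
    then show "\<exists>N. \<forall>i\<ge>N. \<forall>j\<ge>N. dist (w i) (w j) < e" by blast
  qed
  then obtain z where z: "w \<longlonglongrightarrow> z" using convergent_eq_Cauchy by blast
  have "(\<lambda>n. J (w n)) \<longlonglongrightarrow> J z"
    unfolding J_def by (intro tendsto_intros z f.tendsto)
  moreover have "(\<lambda>n. m + inverse (real (Suc n))) \<longlonglongrightarrow> m + 0"
    by (intro tendsto_add tendsto_const LIMSEQ_inverse_real_of_nat)
  ultimately have "J z \<le> m + 0"
    by (rule LIMSEQ_le) (use w less_imp_le in blast)
  then have Jz: "J z \<le> J x" for x using m_le[of x] by simp
  have "f x = z \<bullet> x" for x
  proof (rule ccontr)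
    assume ne: "f x \<noteq> z \<bullet> x"
    define d where "d = z \<bullet> x - f x"
    have "x \<noteq> 0" using ne f.zero by auto
    then have xx: "x \<bullet> x > 0" by simp
    \<comment> \<open>The minimizer of the quadratic
      \<open>t \<mapsto> J (z + t *\<^sub>R x)\<close>; its value falls below \<open>J z\<close> by
      \<open>d\<^sup>2 / (x \<bullet> x)\<close>.\<close>
    define t where "t = - d / (x \<bullet> x)"
    have "J (z + t *\<^sub>R x) - J z = t\<^sup>2 * (x \<bullet> x) + 2 * t * d"
      by (simp add: J_def d_def f.add f.scaleR inner_simps inner_commute power2_eq_square algebra_simps)
    also have "\<dots> = - (d\<^sup>2 / (x \<bullet> x))"
      using xx by (simp add: t_def power2_eq_square field_simps)
    also have "\<dots> < 0" using ne xx by (simp add: d_def)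
    finally show False using Jz[of "z + t *\<^sub>R x"] by simp
  qed
  then show ?thesis using that by blast
qed

section \<open>The standard Gaussian measure on a Euclidean space\<close>

definition std_gaussian :: "'a::euclidean_space measure" where
  "std_gaussian = density lborel (\<lambda>x. ennreal (\<Prod>b\<in>Basis. std_normal_density (x \<bullet> b)))"

lemma sets_std_gaussian [simp, measurable_cong]: "sets std_gaussian = sets borel"
  by (simp add: std_gaussian_def)

lemma space_std_gaussian [simp]: "space std_gaussian = UNIV"
  by (simp add: std_gaussian_def)

lemma prob_space_std_gaussian: "prob_space (std_gaussian :: 'a::euclidean_space measure)"
proof (rule prob_spaceI)
  have one: "(\<integral>\<^sup>+x. ennreal (std_normal_density x) \<partial>lborel) = 1"
    using prob_space_normal_density[of 1 0] prob_space.emeasure_space_1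
    by (fastforce simp: emeasure_density)
  have "emeasure (std_gaussian :: 'a measure) UNIV
      = (\<integral>\<^sup>+x. (\<Prod>b\<in>Basis. ennreal (std_normal_density (x \<bullet> b))) \<partial>(lborel :: 'a measure))"
    by (simp add: std_gaussian_def emeasure_density prod_ennreal)
  also have "\<dots> = (\<Prod>b\<in>(Basis :: 'a set). (\<integral>\<^sup>+x. ennreal (std_normal_density x) \<partial>lborel))"
    by (rule nn_integral_lborel_prod) auto
  finally show "emeasure (std_gaussian :: 'a measure) (space std_gaussian) = 1"
    by (simp add: one)
qed

text \<open>The Gaussian density vanishes nowhere. This turns Gaussian mass along a fiber into
  negligibility, which Lipschitz maps respect.\<close>

lemma null_sets_std_gaussian_iff:
  assumes "A \<in> sets (borel :: 'a::euclidean_space measure)"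
  shows "emeasure std_gaussian A = 0 \<longleftrightarrow> negligible A"
proof -
  have pos: "ennreal (\<Prod>b\<in>Basis. std_normal_density (x \<bullet> b)) \<noteq> 0" for x :: 'a
  proof -
    have "0 < (\<Prod>b\<in>Basis. std_normal_density (x \<bullet> b))"
      by (intro prod_pos) (simp add: normal_density_pos)
    then show ?thesis by (simp add: ennreal_eq_0_iff not_le)
  qed
  have "A \<in> null_sets std_gaussian \<longleftrightarrow> (AE x in lborel. x \<in> A \<longrightarrow> ennreal (\<Prod>b\<in>Basis. std_normal_density (x \<bullet> b)) = 0)"
    unfolding std_gaussian_def using assms by (subst null_sets_density_iff) auto
  also have "\<dots> \<longleftrightarrow> (AE x in lborel. x \<notin> A)"
    by (simp only: pos) simp
  also have "\<dots> \<longleftrightarrow> A \<in> null_sets lborel"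
    using assms by (intro AE_iff_null_sets[symmetric]) simp
  also have "\<dots> \<longleftrightarrow> negligible A"
    using assms by (simp add: negligible_iff_null_sets null_sets_completion_iff)
  finally show ?thesis using assms by (simp add: null_sets_def)
qed

lemma cis_sum: "finite A \<Longrightarrow> cis (sum f A) = (\<Prod>x\<in>A. cis (f x))"
  by (induction A rule: finite_induct) (simp_all flip: cis_mult)

lemma cf_std_gaussian:
  fixes h :: "'a::euclidean_space"
  shows "(CLINT x|std_gaussian. cis (x \<bullet> h)) = of_real (exp (- (h \<bullet> h) / 2))"
proof -
  interpret product_sigma_finite "\<lambda>_. lborel :: real measure" by standard
  let ?g = "\<lambda>(b::'a) x. std_normal_density x *\<^sub>R cis (x * (h \<bullet> b))"
  have int: "integrable lborel (?g b)" for b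
  proof -
    interpret real_distribution std_normal_distribution by (rule real_dist_normal_dist)
    have "integrable std_normal_distribution (\<lambda>x. cis (x * (h \<bullet> b)))"
      by (rule integrable_bounded_by_const[of _ 1]) auto
    then show ?thesis by (subst (asm) integrable_density) auto
  qed
  have g: "(CLINT x|lborel. ?g b x) = of_real (exp (- ((h \<bullet> b)\<^sup>2) / 2))" for b
  proof -
    have "(CLINT x|lborel. ?g b x) = char std_normal_distribution (h \<bullet> b)"
      unfolding char_def by (subst integral_density) (auto simp: cis_conv_exp mult.commute)
    then show ?thesis by (simp add: char_std_normal_distribution)
  qed
  have "(CLINT x|std_gaussian. cis (x \<bullet> h)) = (CLINT x|lborel. (\<Prod>b\<in>Basis. std_normal_density (x \<bullet> b)) *\<^sub>R cis (x \<bullet> h))"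
    unfolding std_gaussian_def by (subst integral_density) (auto intro!: prod_nonneg)
  also have "\<dots> = (CLINT x|lborel. (\<Prod>b\<in>Basis. ?g b (x \<bullet> b)))"
  proof (intro Bochner_Integration.integral_cong refl)
    fix x :: 'a
    have "cis (x \<bullet> h) = (\<Prod>b\<in>Basis. cis ((x \<bullet> b) * (h \<bullet> b)))"
      by (subst euclidean_inner) (simp add: cis_sum)
    then show "(\<Prod>b\<in>Basis. std_normal_density (x \<bullet> b)) *\<^sub>R cis (x \<bullet> h) = (\<Prod>b\<in>Basis. ?g b (x \<bullet> b))"
      by (simp add: scaleR_conv_of_real prod.distrib)
  qed
  \<comment> \<open>Lebesgue measure is the image of a product of lines, where the integral of a
    product of coordinate functions factorizes.\<close>
  also have "\<dots> = (CLINT f|Pi\<^sub>M Basis (\<lambda>_. lborel). (\<Prod>b\<in>Basis. ?g b ((\<Sum>b\<in>Basis. f b *\<^sub>R b) \<bullet> b)))"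
    by (subst lborel_eq, subst integral_distr) auto
  also have "\<dots> = (CLINT f|Pi\<^sub>M Basis (\<lambda>_. lborel). (\<Prod>b\<in>Basis. ?g b (f b)))"
    by (intro Bochner_Integration.integral_cong prod.cong refl) simp
  also have "\<dots> = (\<Prod>b\<in>Basis. CLINT x|lborel. ?g b x)"
    by (rule product_integral_prod) (use int in auto)
  also have "\<dots> = of_real (\<Prod>b\<in>Basis. exp (- ((h \<bullet> b)\<^sup>2) / 2))"
    by (simp only: g of_real_prod)
  also have "(\<Prod>b\<in>Basis. exp (- ((h \<bullet> b)\<^sup>2) / 2)) = exp (- (h \<bullet> h) / 2)"
    by (subst euclidean_inner[of h h]) (simp flip: exp_sum sum_divide_distrib add: sum_negf power2_eq_square)
  finally show ?thesis .
qed

section \<open>Equivalence of measures\<close>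

text \<open>Inner regularity reduces the claim to compact sets, whose images are again compact; so the
  inverse of \<open>T\<close> need not be known to be measurable.\<close>

lemma null_sets_eq_if_distr:
  fixes P Q :: "'a::{second_countable_topology, complete_space} measure"
  assumes P: "finite_measure P" "sets P = sets borel" and Q: "finite_measure Q" "sets Q = sets borel"
    and T: "continuous_on UNIV T" "inj T" and distr: "distr Q borel T = P"
    and null: "\<And>K. compact K \<Longrightarrow> emeasure P K = 0 \<longleftrightarrow> emeasure P (T ` K) = 0"
  shows "null_sets P = null_sets Q"
proof -
  have T_meas: "T \<in> measurable Q borel"
    using borel_measurable_continuous_onI[OF T(1)] measurable_cong_sets[OF Q(2) refl] by blast
  have spQ: "space Q = UNIV" using sets_eq_imp_space_eq[OF Q(2)] by simp
  have cpt: "emeasure Q K = 0 \<longleftrightarrow> emeasure P K = 0" if "compact K" for K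
  proof -
    have "compact (T ` K)"
      using that T(1) by (intro compact_continuous_image) (auto intro: continuous_on_subset)
    then have "emeasure P (T ` K) = emeasure Q (T -` T ` K \<inter> space Q)"
      unfolding distr[symmetric] by (intro emeasure_distr T_meas borel_compact)
    also have "T -` T ` K \<inter> space Q = K" using T(2) spQ by (simp add: inj_vimage_image_eq)
    finally show ?thesis using null[OF that] by simp
  qed
  have reg: "emeasure R A = 0 \<longleftrightarrow> (\<forall>K. compact K \<and> K \<subseteq> A \<longrightarrow> emeasure R K = 0)"
    if "finite_measure R" "sets R = sets borel" "A \<in> sets borel" for R :: "'a measure" and A
  proof -
    have "emeasure R A = (SUP K \<in> {K. K \<subseteq> A \<and> compact K}. emeasure R K)"
      using that finite_measure.emeasure_finite[OF that(1)] by (intro inner_regular) auto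
    then show ?thesis by (auto simp: SUP_eq_iff bot_ennreal[symmetric] SUP_bot_conv)
  qed
  have "A \<in> null_sets P \<longleftrightarrow> A \<in> null_sets Q" for A
    using reg[OF P] reg[OF Q] cpt unfolding null_sets_def by (auto simp: P(2) Q(2))
  then show ?thesis by blast
qed

text \<open>Almost all sections of a null set are null. The inner quantifier is transferred to
  \<open>N'\<close> first, the outer one to \<open>M'\<close> next, and Fubini reassembles
  them.\<close>

lemma absolutely_continuous_pair:
  assumes M: "sigma_finite_measure M" "sigma_finite_measure M'" and N: "sigma_finite_measure N" "sigma_finite_measure N'"
    and sets: "sets M' = sets M" "sets N' = sets N"
    and ac: "absolutely_continuous M M'" "absolutely_continuous N N'"
  shows "absolutely_continuous (M \<Otimes>\<^sub>M N) (M' \<Otimes>\<^sub>M N')"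
proof -
  interpret p: pair_sigma_finite M N by (intro pair_sigma_finite.intro M N)
  interpret p': pair_sigma_finite M' N' by (intro pair_sigma_finite.intro M N)
  have s: "sets (M' \<Otimes>\<^sub>M N') = sets (M \<Otimes>\<^sub>M N)" using sets by (intro sets_pair_measure_cong)
  show ?thesis unfolding absolutely_continuous_def
  proof
    fix A assume A: "A \<in> null_sets (M \<Otimes>\<^sub>M N)"
    then have "AE p in M \<Otimes>\<^sub>M N. p \<notin> A" by (rule AE_not_in)
    then have "AE x in M. AE y in N. (x, y) \<notin> A" by (rule p.AE_pair)
    then have "AE x in M. AE y in N'. (x, y) \<notin> A"
      by eventually_elim (rule absolutely_continuous_AE[OF sets(2) ac(2)])
    then have "AE x in M'. AE y in N'. (x, y) \<notin> A"
      by (rule absolutely_continuous_AE[OF sets(1) ac(1)])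
    moreover have A': "A \<in> sets (M' \<Otimes>\<^sub>M N')" using A s by auto
    ultimately have "AE p in M' \<Otimes>\<^sub>M N'. p \<notin> A"
      by (intro p'.AE_pair_measure) auto
    then show "A \<in> null_sets (M' \<Otimes>\<^sub>M N')" using A' by (simp add: AE_iff_null_sets)
  qed
qed

text \<open>A density cannot vanish on a set charged by the measure it defines, and \<open>N\<close>
  has density \<open>RN_deriv M N\<close>.\<close>

lemma AE_RN_deriv_pos:
  assumes "sigma_finite_measure M" "absolutely_continuous M N" "sets N = sets M"
  shows "AE x in N. RN_deriv M N x > 0"
proof -
  have N: "density M (RN_deriv M N) = N"
    using assms by (rule sigma_finite_measure.density_RN_deriv)
  have "AE x in density M (RN_deriv M N). RN_deriv M N x > 0"
    by (subst AE_density) auto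
  then show ?thesis unfolding N .
qed

text \<open>Lipschitz maps between spaces of equal dimension preserve Lebesgue null sets; this
  applies to \<open>f\<close> and, on its range, to the inverse.\<close>

lemma negligible_bilipschitz_image:
  fixes f :: "'a::euclidean_space \<Rightarrow> 'a"
  assumes f: "L-lipschitz_on UNIV f" "inj f" and inv: "L'-lipschitz_on (range f) (inv f)"
  shows "negligible (f ` A) \<longleftrightarrow> negligible A"
proof
  have lip: "negligible (h ` B)" if "negligible B" "K-lipschitz_on C h" "B \<subseteq> C" for h :: "'a \<Rightarrow> 'a" and B C K
  proof (rule negligible_locally_Lipschitz_image)
    show "\<exists>T k. open T \<and> x \<in> T \<and> (\<forall>y\<in>B \<inter> T. norm (h y - h x) \<le> k * norm (y - x))" if "x \<in> B" for x
      using that \<open>B \<subseteq> C\<close> lipschitz_onD[OF \<open>K-lipschitz_on C h\<close>]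
      by (intro exI[of _ UNIV] exI[of _ K]) (auto simp: dist_norm)
  qed (use that in auto)
  show "negligible A \<Longrightarrow> negligible (f ` A)"
    by (rule lip[OF _ f(1)]) auto
  show "negligible A" if "negligible (f ` A)"
  proof -
    have "negligible (inv f ` f ` A)"
      using that by (rule lip[OF _ inv]) auto
    then show ?thesis using f(2) by (simp add: image_image)
  qed
qed

section \<open>Fibers of the prior along the updated subspace\<close>

text \<open>\<open>S\<close> plays the square root of the covariance, and \<open>psi i\<close> is a
  preimage of \<open>phi i\<close> under it. Pairing with \<open>psi i\<close> makes
  \<open>Rfun\<close> a continuous linear functional, the \<open>i\<close>-th coordinate along a
  fiber.\<close>

locale gaussian_fibers =
  fixes S :: "'a::{real_inner, second_countable_topology} \<Rightarrow> 'a" and phi psi :: "'r::finite \<Rightarrow> 'a"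
  assumes S: "bounded_linear S" "self_adjoint S"
    and phi_on: "\<And>i j. phi i \<bullet> phi j = (if i = j then 1 else 0)"
    and S_psi: "\<And>i. S (psi i) = phi i"
    and Rfun_eq: "\<And>i u. Rfun S phi i u = u \<bullet> psi i"
begin

sublocale S: bounded_linear S by (rule S)

abbreviation "R \<equiv> Rfun S phi"
abbreviation "P \<equiv> Pmap S phi"
abbreviation "X \<equiv> Xmap S phi"

lemma self_adj: "S x \<bullet> y = x \<bullet> S y"
  using S(2) by (simp add: self_adjoint_def)

lemma Rfun_linear: "R i (u + v) = R i u + R i v" "R i (u - v) = R i u - R i v"
  by (simp_all add: Rfun_eq inner_simps)

lemma R_X: "R i (X a) = a $ i"
proof -
  have "R i (X a) = (\<Sum>j\<in>UNIV. a $ j * (phi j \<bullet> phi i))"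
    by (simp add: Rfun_eq Xmap_def inner_sum_left self_adj S_psi)
  then show ?thesis by (simp add: phi_on if_distrib cong: if_cong)
qed

lemma P_eq_X: "P u = X (\<chi> i. R i u)"
  by (simp add: Pmap_def Xmap_def)

lemma R_complement: "R i (u - P u) = 0"
  by (simp add: Rfun_linear P_eq_X R_X)

lemma P_fiber:
  assumes "b \<in> range (\<lambda>u. u - P u)"
  shows "P (b + X a) = X a"
proof -
  have "R i (b + X a) = a $ i" for i
    using assms R_complement by (auto simp: Rfun_linear R_X)
  then show ?thesis by (simp add: P_eq_X)
qed

text \<open>Applying \<open>P\<close> to a point of a fiber recovers \<open>X a\<close>, and
  \<open>R\<close> then recovers the coordinates \<open>a\<close>.\<close>

lemma fiber_unique:
  assumes "b \<in> range (\<lambda>u. u - P u)" "b' \<in> range (\<lambda>u. u - P u)" "b + X a = b' + X a'"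
  shows "b = b'" "a = a'"
proof -
  have "X a = X a'" using P_fiber[OF assms(1), of a] P_fiber[OF assms(2), of a'] assms(3) by simp
  then show "b = b'" "a = a'"
    using assms(3) R_X[of _ a] R_X[of _ a'] by (simp_all add: vec_eq_iff)
qed

lemma continuous_P [continuous_intros]: "continuous_on A P"
  unfolding Pmap_def Rfun_eq by (intro continuous_intros)

lemma continuous_X [continuous_intros]: "continuous_on A f \<Longrightarrow> continuous_on A (\<lambda>x. X (f x))"
  unfolding Xmap_def by (intro continuous_intros)

lemma cf_complement:
  assumes "gaussian_measure M C" "\<And>x. S (S x) = C x"
  shows "(CLINT u|M. cis ((u - P u) \<bullet> h)) = of_real (exp (- (S h \<bullet> S h - (\<Sum>i\<in>UNIV. (phi i \<bullet> S h)\<^sup>2)) / 2))"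
proof -
  define s where "s = (\<lambda>i. phi i \<bullet> S h)"
  \<comment> \<open>The adjoint of \<open>I - P\<close> applied to \<open>h\<close>. The vector
    \<open>S h'\<close> is \<open>S h\<close> minus its projection onto the span of the
    \<open>phi i\<close>, so Pythagoras gives the exponent.\<close>
  define h' where "h' = h - (\<Sum>i\<in>UNIV. s i *\<^sub>R psi i)"
  have Sh': "S h' = S h - (\<Sum>i\<in>UNIV. s i *\<^sub>R phi i)"
    by (simp add: h'_def S.diff S.sum S.scaleR S_psi)
  have "(\<Sum>i\<in>UNIV. s i *\<^sub>R phi i) \<bullet> (\<Sum>i\<in>UNIV. s i *\<^sub>R phi i) = (\<Sum>i\<in>UNIV. (s i)\<^sup>2)"
    by (simp add: inner_sum_left inner_sum_right phi_on if_distrib power2_eq_square cong: if_cong)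
  moreover have "S h \<bullet> (\<Sum>i\<in>UNIV. s i *\<^sub>R phi i) = (\<Sum>i\<in>UNIV. (s i)\<^sup>2)"
    by (simp add: inner_sum_right s_def inner_commute power2_eq_square)
  moreover have "C h' \<bullet> h' = S h' \<bullet> S h'" by (simp add: self_adj flip: assms(2))
  ultimately have norm: "C h' \<bullet> h' = S h \<bullet> S h - (\<Sum>i\<in>UNIV. (s i)\<^sup>2)"
    by (simp add: Sh' inner_diff_left inner_diff_right inner_commute)
  have "(u - P u) \<bullet> h = u \<bullet> h'" for u
    by (simp add: h'_def Pmap_def Rfun_eq inner_diff_left inner_diff_right inner_sum_left inner_sum_right s_def self_adj mult.commute)
  then have "(CLINT u|M. cis ((u - P u) \<bullet> h)) = (CLINT u|M. cis (u \<bullet> h'))" by simp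
  also have "\<dots> = of_real (exp (- (C h' \<bullet> h') / 2))"
    using assms(1) by (simp add: gaussian_measure_def)
  finally show ?thesis by (simp only: norm s_def)
qed

text \<open>The Gaussian vector \<open>X a\<close> supplies exactly the variance that
  \<open>I - P\<close> removes from the prior.\<close>

lemma cf_X: "(CLINT a|std_gaussian. cis (X a \<bullet> h)) = of_real (exp (- (\<Sum>i\<in>UNIV. (phi i \<bullet> S h)\<^sup>2) / 2))"
proof -
  define k :: "real ^ 'r" where "k = (\<chi> i. phi i \<bullet> S h)"
  have "X a \<bullet> h = a \<bullet> k" for a
    by (simp add: Xmap_def inner_sum_left self_adj inner_vec_def k_def)
  moreover have "k \<bullet> k = (\<Sum>i\<in>UNIV. (phi i \<bullet> S h)\<^sup>2)"
    by (simp add: inner_vec_def k_def power2_eq_square)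
  ultimately show ?thesis by (simp add: cf_std_gaussian)
qed

text \<open>Independence multiplies the two transforms; the variances along and off the subspace add
  up to \<open>S h \<bullet> S h\<close>, which is \<open>C h \<bullet> h\<close>.\<close>

lemma gaussian_eq_distr:
  assumes M: "gaussian_measure M C" and C: "\<And>x. S (S x) = C x"
  shows "M = distr (M \<Otimes>\<^sub>M std_gaussian) borel (\<lambda>(u, a). (u - P u) + X a)"
proof -
  let ?G = "std_gaussian :: (real ^ 'r) measure"
  let ?f = "\<lambda>(u, a). (u - P u) + X a"
  interpret M: prob_space M using M by (simp add: gaussian_measure_def)
  have sM [measurable_cong]: "sets M = sets borel" using M by (simp add: gaussian_measure_def)
  interpret G: prob_space ?G by (rule prob_space_std_gaussian)
  interpret pair_prob_space M ?G by standard
  have [measurable]: "P \<in> borel_measurable borel" "X \<in> borel_measurable borel"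
    by (intro borel_measurable_continuous_onI continuous_intros continuous_X[OF continuous_on_id])+
  have "same_cf M (distr (M \<Otimes>\<^sub>M ?G) borel ?f)"
    unfolding same_cf_def
  proof (intro conjI allI)
    show "finite_measure M" by (rule M.finite_measure_axioms)
    show "finite_measure (distr (M \<Otimes>\<^sub>M ?G) borel ?f)"
      by (rule finite_measure_distr) measurable
    fix h
    have int: "integrable (M \<Otimes>\<^sub>M ?G) (\<lambda>(u, a). cis ((u - P u) \<bullet> h) * cis (X a \<bullet> h))"
      by (rule integrable_bounded_by_const[of _ 1]) (auto simp: norm_mult)
    have "(CLINT p|distr (M \<Otimes>\<^sub>M ?G) borel ?f. cis (p \<bullet> h))
        = (CLINT p|M \<Otimes>\<^sub>M ?G. case p of (u, a) \<Rightarrow> cis ((u - P u) \<bullet> h) * cis (X a \<bullet> h))"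
      by (subst integral_distr) (auto intro!: Bochner_Integration.integral_cong simp: cis_mult inner_add_left)
    also have "\<dots> = (CLINT u|M. CLINT a|?G. cis ((u - P u) \<bullet> h) * cis (X a \<bullet> h))"
      using integral_fst'[OF int] by simp
    also have "\<dots> = (CLINT u|M. cis ((u - P u) \<bullet> h)) * (CLINT a|?G. cis (X a \<bullet> h))"
      by simp
    also have "\<dots> = of_real (exp (- (C h \<bullet> h) / 2))"
      by (simp add: cf_complement[OF M C] cf_X self_adj flip: C exp_add of_real_mult)
         (simp add: field_simps)
    finally show "(CLINT x|M. cis (x \<bullet> h)) = (CLINT p|distr (M \<Otimes>\<^sub>M ?G) borel ?f. cis (p \<bullet> h))"
      using M by (simp add: gaussian_measure_def)
  qed (simp_all add: sM)
  then show ?thesis by (rule same_cf_imp_eq)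
qed

text \<open>By the product representation and Tonelli, the mass of \<open>A\<close> is the integral
  over \<open>u\<close> of the Gaussian mass of its slices; it vanishes iff almost all slices are
  Gaussian null, that is, negligible.\<close>

lemma gaussian_null_iff:
  assumes M: "gaussian_measure M C" and C: "\<And>x. S (S x) = C x" and A: "A \<in> sets borel"
  shows "emeasure M A = 0 \<longleftrightarrow> (AE u in M. negligible {a. (u - P u) + X a \<in> A})"
proof -
  let ?G = "std_gaussian :: (real ^ 'r) measure"
  let ?f = "\<lambda>(u, a). (u - P u) + X a"
  interpret M: prob_space M using M by (simp add: gaussian_measure_def)
  have sM [measurable_cong]: "sets M = sets borel" using M by (simp add: gaussian_measure_def)
  interpret G: prob_space ?G by (rule prob_space_std_gaussian)
  have [measurable]: "P \<in> borel_measurable borel" "X \<in> borel_measurable borel"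
    by (intro borel_measurable_continuous_onI continuous_intros continuous_X[OF continuous_on_id])+
  define B where "B = ?f -` A \<inter> space (M \<Otimes>\<^sub>M ?G)"
  have B: "B \<in> sets (M \<Otimes>\<^sub>M ?G)" unfolding B_def using A by (intro measurable_sets[of _ _ borel]) auto
  have spM: "space M = UNIV" using sets_eq_imp_space_eq[OF sM] by simp
  have slice: "Pair u -` B = {a. (u - P u) + X a \<in> A}" for u
    by (auto simp: B_def space_pair_measure spM)
  have "{a. (u - P u) + X a \<in> A} \<in> sets borel" for u
    using sets_Pair1[OF B, of u] by (simp add: slice)
  note nul = null_sets_std_gaussian_iff[OF this]
  have "emeasure M A = emeasure (M \<Otimes>\<^sub>M ?G) B"
    unfolding B_def using A by (subst gaussian_eq_distr[OF M C], subst emeasure_distr) auto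
  also have "\<dots> = (\<integral>\<^sup>+u. emeasure ?G (Pair u -` B) \<partial>M)"
    using B by (rule G.emeasure_pair_measure_alt)
  finally have "emeasure M A = 0 \<longleftrightarrow> (AE u in M. emeasure ?G (Pair u -` B) = 0)"
    using B by (simp add: nn_integral_0_iff_AE G.measurable_emeasure_Pair)
  then show ?thesis by (simp add: slice nul)
qed

text \<open>Distinct fibers are disjoint and \<open>T\<close> maps each into itself, so a point of
  the image lying on the fiber of \<open>b\<close> can only come from that fiber.\<close>

lemma fiberwise_image:
  assumes T: "\<And>b a. b \<in> range (\<lambda>u. u - P u) \<Longrightarrow> T (b + X a) = b + X (H b a)"
    and b: "b \<in> range (\<lambda>u. u - P u)"
  shows "{a. b + X a \<in> T ` A} = H b ` {a. b + X a \<in> A}"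
proof (intro equalityI subsetI)
  fix a assume "a \<in> {a. b + X a \<in> T ` A}"
  then obtain u where u: "u \<in> A" "b + X a = T u" by auto
  define b' a' where "b' = u - P u" and "a' = (\<chi> i. R i u)"
  have b': "b' \<in> range (\<lambda>u. u - P u)" and u': "u = b' + X a'"
    by (auto simp: b'_def a'_def P_eq_X)
  have "b + X a = b' + X (H b' a')" using u(2) T[OF b'] u' by simp
  from fiber_unique[OF b b' this] show "a \<in> H b ` {a. b + X a \<in> A}"
    using u(1) u' by auto
qed (auto simp flip: T[OF b])

lemma fiberwise_inj:
  assumes T: "\<And>b a. b \<in> range (\<lambda>u. u - P u) \<Longrightarrow> T (b + X a) = b + X (H b a)"
    and H: "\<And>b. b \<in> range (\<lambda>u. u - P u) \<Longrightarrow> inj (H b)"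
  shows "inj T"
proof (rule injI)
  fix u v assume eq: "T u = T v"
  define b a b' a' where "b = u - P u" and "a = (\<chi> i. R i u)" and "b' = v - P v" and "a' = (\<chi> i. R i v)"
  have b: "b \<in> range (\<lambda>u. u - P u)" "b' \<in> range (\<lambda>u. u - P u)" and uv: "u = b + X a" "v = b' + X a'"
    by (auto simp: b_def b'_def a_def a'_def P_eq_X)
  have "b + X (H b a) = b' + X (H b' a')" using eq T b uv by simp
  from fiber_unique[OF b this] show "u = v"
    using H[OF b(1)] uv by (auto dest: injD)
qed

end

section \<open>Application to the RTO map\<close>

lemma negligible_scale_shift_image:
  fixes k :: "real ^ 'r::finite" and s :: "'r \<Rightarrow> real"
  assumes s: "\<And>i. s i \<noteq> 0"
  shows "negligible ((\<lambda>a. \<chi> i. (a $ i + k $ i) / s i) ` A) \<longleftrightarrow> negligible A"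
proof -
  let ?D = "\<lambda>a :: real ^ 'r. \<chi> i. a $ i / s i"
  let ?E = "\<lambda>a :: real ^ 'r. \<chi> i. s i * a $ i"
  have lin: "linear ?D" "linear ?E"
    by (intro linearI; simp add: vec_eq_iff add_divide_distrib distrib_left)+
  have "?E (?D x) = x" for x
    using s by (simp add: vec_eq_iff)
  then have "?E ` ?D ` (+) k ` A = (+) k ` A"
    by (simp only: image_image)
  have image: "negligible (f ` B)" if "negligible B" "linear f" for f :: "real ^ 'r \<Rightarrow> real ^ 'r" and B
    using that by (intro negligible_differentiable_image_negligible linear_imp_differentiable_on) auto
  have "negligible (?D ` (+) k ` A) \<longleftrightarrow> negligible ((+) k ` A)"
    using image[OF _ lin(1), of "(+) k ` A"] image[OF _ lin(2), of "?D ` (+) k ` A"]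
      \<open>?E ` ?D ` (+) k ` A = (+) k ` A\<close> by auto
  also have "\<dots> \<longleftrightarrow> negligible A"
    using negligible_translation negligible_translation_rev by blast
  finally show ?thesis by (simp add: image_image add.commute)
qed

theorem theorem4p2:
  fixes Gpr Ghalf :: "'a::{real_inner, complete_space, second_countable_topology} \<Rightarrow> 'a"
    and mu_pr mu_tar mu_RTO :: "'a measure"
    and F :: "'a \<Rightarrow> real ^ 'm"
    and F' :: "'a \<Rightarrow> ('a \<Rightarrow>\<^sub>L (real ^ 'm))"
    and y :: "real ^ 'm"
    and S_obs :: "real ^ 'm ^ 'm"
    and v_ref :: 'a
    and Psi :: "'r::finite \<Rightarrow> real ^ 'm"
    and lam :: "'r \<Rightarrow> real"
    and phi :: "'r \<Rightarrow> 'a"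
  assumes separable: "\<exists>D::'a set. countable D \<and> closure D = UNIV"
    and Gpr_bl: "bounded_linear Gpr"
    and Gpr_sa: "self_adjoint Gpr"
    and Gpr_pd: "positive_definite_op Gpr"
    and Gpr_tr: "trace_class_pos Gpr"
    and Ghalf_sqrt: "is_sqrt_op Gpr Ghalf"
    and prior: "gaussian_measure mu_pr Gpr"
    and F_deriv: "\<And>u. (F has_derivative blinfun_apply (F' u)) (at u)"
    and F'_cont: "continuous_on UNIV F'"
    and S_inv: "invertible S_obs"
    and tar: "mu_tar = density mu_pr (\<lambda>u. ennreal (exp (- misfit S_obs F y u / 2)
                   / (\<integral>w. exp (- misfit S_obs F y w / 2) \<partial>mu_pr)))"
    and tar_equiv: "absolutely_continuous mu_pr mu_tar" "absolutely_continuous mu_tar mu_pr"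
    and Psi_on: "\<And>i j. Psi i \<bullet> Psi j = (if i = j then 1 else 0)"
    and phi_on: "\<And>i j. phi i \<bullet> phi j = (if i = j then 1 else 0)"
    and lam_pos: "\<And>i. lam i > 0"
    and svd: "\<And>v. matrix_inv S_obs *v (blinfun_apply (F' (Ghalf v_ref)) (Ghalf v))
                 = (\<Sum>i\<in>UNIV. (lam i * (phi i \<bullet> v)) *\<^sub>R Psi i)"
    and RTO_prob: "prob_space mu_RTO"
    and RTO_sets: "sets mu_RTO = sets borel"
    and RTO_law: "distr mu_RTO borel (rto_map Ghalf phi lam Psi S_obs F y) = mu_pr"
    and map_props: "\<And>b. b \<in> range (\<lambda>u. u - Pmap Ghalf phi u) \<Longrightarrow>
        (let g = (\<lambda>a::real ^ 'r. a + (\<chi> i. lam i * (Psi i \<bullet> (matrix_inv S_obs *v F (Xmap Ghalf phi a + b)))))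
         in (\<exists>L. L-lipschitz_on UNIV g) \<and> inj g \<and> (\<exists>L. L-lipschitz_on (range g) (inv g)))"
  shows "AE p in mu_pr \<Otimes>\<^sub>M mu_pr. mh_alpha mu_tar mu_RTO p > 0"
proof -
  have pr: "prob_space mu_pr" and pr_sets: "sets mu_pr = sets borel"
    using prior by (simp_all add: gaussian_measure_def)
  interpret pr: prob_space mu_pr by (rule pr)
  interpret RTO: prob_space mu_RTO by (rule RTO_prob)
  have half: "bounded_linear Ghalf" "self_adjoint Ghalf" and half2: "\<And>x. Ghalf (Ghalf x) = Gpr x"
    using Ghalf_sqrt by (auto simp: is_sqrt_op_def)
  interpret Ghalf: bounded_linear Ghalf by fact
  define Si where "Si = matrix_inv S_obs"
  let ?T = "rto_map Ghalf phi lam Psi S_obs F y"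

  \<comment> \<open>The kernel of \<open>Ghalf\<close> lies in that of \<open>Gpr\<close>, which is
    trivial by positive definiteness. Injectivity lets the inverses in \<open>Rfun\<close>
    cancel.\<close>
  have "inj Ghalf"
  proof (rule injI)
    fix x z assume "Ghalf x = Ghalf z"
    then have "Ghalf (x - z) = 0" by (simp add: Ghalf.diff)
    then have "Gpr (x - z) \<bullet> (x - z) = 0" by (simp add: Ghalf.zero flip: half2)
    then have "x - z = 0" using Gpr_pd unfolding positive_definite_op_def by (metis less_irrefl)
    then show "x = z" by simp
  qed

  text \<open>The SVD exhibits the right singular vectors as elements of the range of the square
    root, without which \<open>Rfun\<close> would apply \<open>inv\<close> outside the range.\<close>
  have "\<exists>w. Ghalf w = phi i" for i
  proof -
    \<comment> \<open>Composed with \<open>Ghalf\<close>, this functional is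
      \<open>lam i * (phi i \<bullet> v)\<close> by the SVD. Its Riesz vector \<open>w\<close>
      therefore satisfies \<open>Ghalf w = lam i *\<^sub>R phi i\<close> by
      self-adjointness.\<close>
    have "bounded_linear (\<lambda>v. Psi i \<bullet> (Si *v blinfun_apply (F' (Ghalf v_ref)) v))"
      by (intro bounded_linear_inner_right_comp bounded_linear_compose[OF matrix_vector_mul_bounded_linear]
          blinfun.bounded_linear_right)
    from riesz_representation[OF this]
    obtain w where w: "\<And>v. Psi i \<bullet> (Si *v blinfun_apply (F' (Ghalf v_ref)) v) = w \<bullet> v" by blast
    have "(lam i *\<^sub>R phi i - Ghalf w) \<bullet> v = 0" for v
    proof -
      have "Ghalf w \<bullet> v = Psi i \<bullet> (Si *v blinfun_apply (F' (Ghalf v_ref)) (Ghalf v))"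
        using half(2) by (simp add: w self_adjoint_def)
      also have "\<dots> = lam i * (phi i \<bullet> v)"
        by (simp add: Si_def svd inner_sum_right Psi_on if_distrib cong: if_cong)
      finally show ?thesis by (simp add: inner_diff_left)
    qed
    then have "lam i *\<^sub>R phi i = Ghalf w" using inner_eq_zero_iff by (metis eq_iff_diff_eq_0)
    then have "Ghalf ((1 / lam i) *\<^sub>R w) = phi i"
      using lam_pos[of i] by (simp add: Ghalf.scaleR flip: \<open>lam i *\<^sub>R phi i = Ghalf w\<close>)
    then show ?thesis by blast
  qed
  then obtain psi where psi: "\<And>i. Ghalf (psi i) = phi i" by metis
  interpret gaussian_fibers Ghalf phi psi
  proof
    show "Rfun Ghalf phi i u = u \<bullet> psi i" for i u
      using \<open>inj Ghalf\<close> by (simp add: Rfun_def inv_f_f flip: psi)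
  qed (use half phi_on psi in auto)

  define s where "s = (\<lambda>i. sqrt ((lam i)\<^sup>2 + 1))"
  have s: "s i \<noteq> 0" for i
    using zero_le_power2[of "lam i"] by (simp add: s_def add_nonneg_eq_0_iff)
  \<comment> \<open>\<open>g\<close> is the map of the hypothesis; the data \<open>y\<close> enters
    \<open>H\<close> through the shift \<open>k\<close>, and division by \<open>s\<close> is the
    factor \<open>(Lambda^2 + I)^(-1/2)\<close>. Thus \<open>H b\<close> is the RTO map in the
    coordinates of the fiber through \<open>b\<close>.\<close>
  define g where "g = (\<lambda>b a :: real ^ 'r. a + (\<chi> i. lam i * (Psi i \<bullet> (Si *v F (X a + b)))))"
  define k where "k = (\<chi> i. - (lam i * (Psi i \<bullet> (Si *v y))))"
  define H where "H = (\<lambda>b a. \<chi> i. (g b a $ i + k $ i) / s i)"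
  let ?W = "range (\<lambda>u. u - P u)"

  have T_fiber: "?T (b + X a) = b + X (H b a)" if b: "b \<in> ?W" for a b
  proof -
    have "R i (b + X a) = a $ i" for i
      using b R_complement by (auto simp: Rfun_linear R_X)
    then show ?thesis
      by (simp add: rto_map_def P_fiber[OF b] H_def g_def k_def s_def Si_def
          add.commute matrix_vector_mult_diff_distrib inner_diff_right right_diff_distrib)
         (simp add: algebra_simps)
  qed
  have g_props: "\<exists>L. L-lipschitz_on UNIV (g b)" "inj (g b)" "\<exists>L. L-lipschitz_on (range (g b)) (inv (g b))"
    if "b \<in> ?W" for b
    using map_props[OF that] by (simp_all add: g_def Si_def Let_def)
  have H_inj: "inj (H b)" if "b \<in> ?W" for b
    using g_props(2)[OF that] s by (auto intro!: injI simp: H_def vec_eq_iff dest: injD)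
  have H_negl: "negligible (H b ` A) \<longleftrightarrow> negligible A" if b: "b \<in> ?W" for b A
  proof -
    obtain L L' where "L-lipschitz_on UNIV (g b)" "L'-lipschitz_on (range (g b)) (inv (g b))"
      using g_props[OF b] by blast
    then have "negligible (g b ` A) \<longleftrightarrow> negligible A"
      using g_props(2)[OF b] by (intro negligible_bilipschitz_image)
    moreover have "H b ` A = (\<lambda>a. \<chi> i. (a $ i + k $ i) / s i) ` g b ` A" by (simp add: H_def image_image)
    ultimately show ?thesis
      by (simp only: negligible_scale_shift_image[OF s])
  qed
  have "continuous_on UNIV F"
    using F_deriv by (intro differentiable_imp_continuous_on differentiable_at_imp_differentiable_on) (auto simp: differentiable_def)
  note [continuous_intros] = this bounded_linear.continuous_on[OF matrix_vector_mul_bounded_linear]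
  have T_cont: "continuous_on UNIV ?T"
    unfolding rto_map_def Rfun_eq
    using s by (intro continuous_intros) (auto simp: s_def)

  have null: "null_sets mu_pr = null_sets mu_RTO"
  proof (rule null_sets_eq_if_distr[OF _ pr_sets _ RTO_sets T_cont _ RTO_law])
    show "finite_measure mu_pr" "finite_measure mu_RTO"
      by (rule pr.finite_measure_axioms RTO.finite_measure_axioms)+
    show "inj ?T" using T_fiber H_inj by (rule fiberwise_inj)
    fix K :: "'a set" assume K: "compact K"
    then have "compact (?T ` K)"
      using T_cont by (intro compact_continuous_image) (auto intro: continuous_on_subset)
    moreover have "negligible {a. u - P u + X a \<in> ?T ` K} \<longleftrightarrow> negligible {a. u - P u + X a \<in> K}" for u
      using H_negl[of "u - P u"] by (subst fiberwise_image[OF T_fiber]) auto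
    ultimately show "emeasure mu_pr K = 0 \<longleftrightarrow> emeasure mu_pr (?T ` K) = 0"
      using K gaussian_null_iff[OF prior half2] by (simp add: borel_compact)
  qed

  have misfit_meas: "misfit S_obs F y \<in> borel_measurable borel"
    unfolding misfit_def by (intro borel_measurable_continuous_onI continuous_intros)
  have tar_sets: "sets mu_tar = sets borel" by (simp add: tar pr_sets)
  \<comment> \<open>The density is real-valued, hence finite everywhere, which gives
    sigma-finiteness.\<close>
  have tar_sf: "sigma_finite_measure mu_tar"
    unfolding tar using misfit_meas pr_sets
    by (subst pr.sigma_finite_iff_density_finite) (auto cong: measurable_cong_sets)
  have ac: "absolutely_continuous mu_tar mu_RTO" "absolutely_continuous mu_RTO mu_tar" "absolutely_continuous mu_RTO mu_pr"
    using tar_equiv null by (auto simp: absolutely_continuous_def)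
  note sf = pr.sigma_finite_measure_axioms RTO.sigma_finite_measure_axioms tar_sf
  note st = pr_sets RTO_sets tar_sets
  \<comment> \<open>Positivity holds first almost everywhere for the numerator measure; it passes to
    the product of priors because that product is absolutely continuous with respect to it.\<close>
  have "AE p in mu_RTO \<Otimes>\<^sub>M mu_tar. RN_deriv (mu_tar \<Otimes>\<^sub>M mu_RTO) (mu_RTO \<Otimes>\<^sub>M mu_tar) p > 0"
  proof (rule AE_RN_deriv_pos)
    interpret pair_sigma_finite mu_tar mu_RTO by (intro pair_sigma_finite.intro sf)
    show "sigma_finite_measure (mu_tar \<Otimes>\<^sub>M mu_RTO)" ..
    show "absolutely_continuous (mu_tar \<Otimes>\<^sub>M mu_RTO) (mu_RTO \<Otimes>\<^sub>M mu_tar)"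
      by (intro absolutely_continuous_pair sf ac) (simp_all add: st)
    show "sets (mu_RTO \<Otimes>\<^sub>M mu_tar) = sets (mu_tar \<Otimes>\<^sub>M mu_RTO)"
      by (intro sets_pair_measure_cong) (simp_all add: st)
  qed
  moreover have "absolutely_continuous (mu_RTO \<Otimes>\<^sub>M mu_tar) (mu_pr \<Otimes>\<^sub>M mu_pr)"
    by (intro absolutely_continuous_pair sf ac tar_equiv) (simp_all add: st)
  moreover have "sets (mu_pr \<Otimes>\<^sub>M mu_pr) = sets (mu_RTO \<Otimes>\<^sub>M mu_tar)"
    by (intro sets_pair_measure_cong) (simp_all add: st)
  ultimately have "AE p in mu_pr \<Otimes>\<^sub>M mu_pr. RN_deriv (mu_tar \<Otimes>\<^sub>M mu_RTO) (mu_RTO \<Otimes>\<^sub>M mu_tar) p > 0"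
    using absolutely_continuous_AE by blast
  then show ?thesis by (simp add: mh_alpha_def)
qed

end
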